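(* Let $m_1,m_2$ be positive integers and let $f_1,f_2:\mathbb{N}\to\mathbb{C}$ be two multiplicative functions, with periods $m_1$ and $m_2$ respectively, such that, for each $j\in\{1,2\}$: (i) for some prime $q\mid m_j$, $\sum_{k=0}^\infty \frac{f_j(q^k)}{q^k}=0$; (ii) for each prime power $p^a\,\|\,m_j$ ($p$ prime), $f_j(p^k)=f_j(p^a)$ for all $k\geq a$; (iii) for each prime $p$ with $\gcd(p,m_j)=1$, $f_j(p^k)=1$ for all $k\geq 1$. Let $f=f_1\ast f_2$. Then, for all real $x>m_1m_2$, $$\sum_{n\leq x}f(n)=\sum_{n\mid m_1m_2}(f\ast\mu\ast\mu)(n)\,\Delta\left(\frac{x}{n}\right).$$
   Context: $\mathbb{N}=\{1,2,3,\dots\}$. A function $f:\mathbb{N}\to\mathbb{C}$ is multiplicative if $f(1)=1$ and $f(nm)=f(n)f(m)$ whenever $n$ and $m$ are relatively prime. $f$ has period $m$ if $f(n+m)=f(n)$ for all $n\in\mathbb{N}$ ($m$ not necessarily minimal). The notation $p^a\,\|\,m$ means that $p^a$ is the largest power of $p$ dividing $m$. $\ast$ denotes Dirichlet convolution, $(f_1\ast f_2)(n)=\sum_{d\mid n}f_1(d)f_2(n/d)$. $\mu$ is the Möbius function. $\tau(n)=\sum_{d\mid n}1$ is the divisor function, and $\Delta(x)$ is the error term in the Dirichlet divisor problem, defined by $$\sum_{n\leq x}\tau(n)=x\log x+(2\gamma-1)x+\Delta(x),$$ where $\gamma$ is the Euler–Mascheroni constant. *)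

theory Defs
  imports "HOL-Analysis.Analysis" "HOL-Computational_Algebra.Computational_Algebra"
begin

text \<open>
  An arithmetic function on the positive integers is represented by a function on type
  \<open>nat\<close>. Its value at \<open>0\<close> is junk: all conditions below range over positive arguments only.
\<close>

definition multiplicative :: "(nat \<Rightarrow> complex) \<Rightarrow> bool" where
  "multiplicative f \<longleftrightarrow>
     f 1 = 1 \<and> (\<forall>n>0. \<forall>m>0. coprime n m \<longrightarrow> f (n * m) = f n * f m)"

definition has_period :: "(nat \<Rightarrow> complex) \<Rightarrow> nat \<Rightarrow> bool" where
  "has_period f m \<longleftrightarrow> (\<forall>n>0. f (n + m) = f n)"

text \<open>The notation $p^a \| m$.\<close>

definition exact_power_dvd :: "nat \<Rightarrow> nat \<Rightarrow> nat \<Rightarrow> bool" where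
  "exact_power_dvd p a m \<longleftrightarrow> p ^ a dvd m \<and> \<not> p ^ Suc a dvd m"

text \<open>
  At \<open>n = 0\<close> the index set is infinite, so the sum is \<open>0\<close> by convention.
\<close>

definition dirichlet_conv :: "(nat \<Rightarrow> complex) \<Rightarrow> (nat \<Rightarrow> complex) \<Rightarrow> nat \<Rightarrow> complex"
    (infixl "\<star>" 70) where
  "(f \<star> g) n = (\<Sum>d | d dvd n. f d * g (n div d))"

definition moebius_mu :: "nat \<Rightarrow> complex" where
  "moebius_mu n = (if squarefree n then (- 1) ^ card (prime_factors n) else 0)"

definition tau :: "nat \<Rightarrow> nat" where
  "tau n = (\<Sum>d | d dvd n. 1)"

definition divisor_Delta :: "real \<Rightarrow> real" where
  "divisor_Delta x =
     (\<Sum>n | 0 < n \<and> real n \<le> x. real (tau n))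
       - (x * ln x + (2 * euler_mascheroni - 1) * x)"

end

theory Submission
  imports Defs
begin

text \<open>
  Write \<open>g\<^sub>j = f\<^sub>j \<star> \<mu>\<close>. Conditions (ii) and (iii) say that \<open>f\<^sub>j(p\<^sup>k)\<close> is constant in
  \<open>k \<ge> a\<close>, where \<open>a\<close> is the exponent of \<open>p\<close> in \<open>m\<^sub>j\<close>. So the differences
  \<open>g\<^sub>j(p\<^sup>k) = f\<^sub>j(p\<^sup>k) - f\<^sub>j(p\<^sup>k\<^sup>-\<^sup>1)\<close> vanish for \<open>k > a\<close>, and by multiplicativity
  \<open>g\<^sub>j\<close> lives on the divisors of \<open>m\<^sub>j\<close> (\<open>moebius_conv_eq_0\<close>). Thus the Dirichlet series of
  \<open>g\<^sub>j\<close> is a Dirichlet polynomial \<open>P\<^sub>j(s)\<close>, it factors over the primes dividing \<open>m\<^sub>j\<close>, and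
  condition (i) makes the factor at \<open>q\<close>, hence \<open>P\<^sub>j\<close> itself, vanish at \<open>s = 1\<close>
  (\<open>sum_moebius_conv_over_id_eq_0\<close>).

  The function \<open>G = f \<star> \<mu> \<star> \<mu> = g\<^sub>1 \<star> g\<^sub>2\<close> has the Dirichlet polynomial \<open>P\<^sub>1 P\<^sub>2\<close>, which
  therefore has a double zero at \<open>s = 1\<close>:
  \<open>\<Sum> G(d) / d = 0\<close> and \<open>\<Sum> G(d) (ln d) / d = 0\<close>, the sums running over the divisors
  of \<open>m\<^sub>1 m\<^sub>2\<close> (\<open>double_zero\<close>). By Moebius inversion \<open>f = G \<star> \<tau>\<close>, so the summatory function
  of \<open>f\<close> at \<open>x\<close> is the sum of \<open>G(d) T(x/d)\<close>, where \<open>T(y)\<close> is the summatory function of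
  \<open>\<tau>\<close>, that is, \<open>T(y) = y ln y + (2 \<gamma> - 1) y + \<Delta>(y)\<close>. The double zero annihilates
  the main terms \<open>(x/d) (ln x - ln d + 2 \<gamma> - 1)\<close> and only the terms \<open>G(d) \<Delta>(x/d)\<close> remain.
\<close>

section \<open>Dirichlet convolution\<close>

lemma dirichlet_conv_0 [simp]: "(f \<star> g) 0 = 0"
  by (simp add: dirichlet_conv_def)

lemma dirichlet_conv_commute: "f \<star> g = g \<star> f"
proof
  fix n show "(f \<star> g) n = (g \<star> f) n"
  proof (cases "n = 0")
    case False
    then show ?thesis unfolding dirichlet_conv_def
      by (intro sum.reindex_bij_witness[of _ "\<lambda>d. n div d" "\<lambda>d. n div d"])
         (auto elim!: dvdE)
  qed simp
qed

lemma dirichlet_conv_assoc: "(f \<star> g) \<star> h = f \<star> (g \<star> h)"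
proof
  fix n show "((f \<star> g) \<star> h) n = (f \<star> (g \<star> h)) n"
  proof (cases "n = 0")
    case False
    then have n: "n > 0" by simp
    have fin: "finite {e. e dvd d}" if "d dvd n" for d
      using that n by (auto intro: finite_divisors_nat dvd_pos_nat)
    have fin': "finite {e. e dvd n div d}" if "d dvd n" for d
      using that n by (intro finite_divisors_nat) (auto elim!: dvdE)
    have "((f \<star> g) \<star> h) n
        = (\<Sum>d | d dvd n. \<Sum>a | a dvd d. f a * g (d div a) * h (n div d))"
      by (simp add: dirichlet_conv_def sum_distrib_right)
    also have "\<dots> = (\<Sum>(d, a)\<in>(SIGMA d:{d. d dvd n}. {a. a dvd d}).
                       f a * g (d div a) * h (n div d))"
      using n fin by (subst sum.Sigma) auto
    also have "\<dots> = (\<Sum>(a, b)\<in>(SIGMA a:{a. a dvd n}. {b. b dvd n div a}).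
                       f a * (g b * h (n div a div b)))"
      using n
      by (intro sum.reindex_bij_witness[of _ "\<lambda>(a, b). (a * b, a)" "\<lambda>(d, a). (a, d div a)"])
         (auto elim!: dvdE simp: mult.assoc)
    also have "\<dots> = (\<Sum>a | a dvd n. \<Sum>b | b dvd n div a. f a * (g b * h (n div a div b)))"
      using n fin' by (subst sum.Sigma) auto
    also have "\<dots> = (f \<star> (g \<star> h)) n"
      by (simp add: dirichlet_conv_def sum_distrib_left)
    finally show ?thesis .
  qed simp
qed

lemma dirichlet_conv_left_commute: "f \<star> (g \<star> h) = g \<star> (f \<star> h)"
  by (metis dirichlet_conv_assoc dirichlet_conv_commute)

lemmas dirichlet_conv_ac =
  dirichlet_conv_assoc dirichlet_conv_commute dirichlet_conv_left_commute

text \<open>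
  The weight \<open>\<phi>\<close> and the set \<open>A\<close> are left open because the same rearrangement serves twice:
  for values of Dirichlet polynomials, with \<open>A\<close> the divisors of a number, and for summatory
  functions, with \<open>A\<close> an initial segment.
\<close>
lemma sum_dirichlet_conv:
  assumes "finite A" "0 \<notin> A"
  shows "(\<Sum>n\<in>A. (g \<star> h) n * \<phi> n) = (\<Sum>(a, b) | a * b \<in> A. g a * h b * \<phi> (a * b))"
proof -
  have "(\<Sum>n\<in>A. (g \<star> h) n * \<phi> n) = (\<Sum>n\<in>A. \<Sum>a | a dvd n. g a * h (n div a) * \<phi> n)"
    by (simp add: dirichlet_conv_def sum_distrib_right)
  also have "\<dots> = (\<Sum>(n, a)\<in>(SIGMA n:A. {a. a dvd n}). g a * h (n div a) * \<phi> n)"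
    using assms by (subst sum.Sigma) (auto intro!: finite_divisors_nat gr0I)
  also have "\<dots> = (\<Sum>(a, b) | a * b \<in> A. g a * h b * \<phi> (a * b))"
    using assms
    by (intro sum.reindex_bij_witness[of _ "\<lambda>(a, b). (a * b, a)" "\<lambda>(n, a). (a, n div a)"])
       (auto elim!: dvdE intro!: nonzero_mult_div_cancel_left gr0I)
  finally show ?thesis .
qed

lemma dirichlet_conv_prime_power:
  assumes "prime p"
  shows "(f \<star> g) (p ^ k) = (\<Sum>i\<le>k. f (p ^ i) * g (p ^ (k - i)))"
proof -
  have p: "p > 1" using assms by (rule prime_gt_1_nat)
  have D: "{d. d dvd p ^ k} = (\<lambda>i. p ^ i) ` {..k}"
    using divides_primepow_nat[OF assms] by auto
  show ?thesis unfolding dirichlet_conv_def D using p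
    by (subst sum.reindex) (auto simp: inj_on_def power_diff intro!: sum.cong)
qed

section \<open>Multiplicative functions\<close>

lemma multiplicative_1: "multiplicative f \<Longrightarrow> f (Suc 0) = 1"
  by (simp add: multiplicative_def)

lemma multiplicative_mult:
  "multiplicative f \<Longrightarrow> n > 0 \<Longrightarrow> m > 0 \<Longrightarrow> coprime n m \<Longrightarrow> f (n * m) = f n * f m"
  by (simp add: multiplicative_def)

text \<open>
  For coprime \<open>n\<close> and \<open>m\<close>, a divisor of \<open>n m\<close> is a divisor of \<open>n\<close> times a divisor of
  \<open>m\<close>, the two being recovered as greatest common divisors.
\<close>
lemma multiplicative_dirichlet_conv:
  assumes f: "multiplicative f" and g: "multiplicative g"
  shows "multiplicative (f \<star> g)"
  unfolding multiplicative_def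
proof (intro conjI allI impI)
  have "{d. d dvd Suc 0} = {1}" by auto
  then show "(f \<star> g) 1 = 1"
    using multiplicative_1[OF f] multiplicative_1[OF g] by (simp add: dirichlet_conv_def)
next
  fix n m :: nat
  assume n: "n > 0" and m: "m > 0" and co: "coprime n m"
  have gcd1: "gcd (a * b) n = a" if "a dvd n" "b dvd m" for a b
  proof -
    have "coprime b n" using co that(2) by (metis coprime_commute coprime_divisors dvd_refl)
    then have "gcd (a * b) n = gcd a n"
      by (simp add: gcd_mult_right_right_cancel gcd.commute coprime_commute)
    then show ?thesis using that(1) by (simp add: gcd_nat.absorb1)
  qed
  have gcd2: "gcd (a * b) m = b" if "a dvd n" "b dvd m" for a b
  proof -
    have "coprime a m" using co that(1) by (metis coprime_divisors dvd_refl)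
    then have "gcd (a * b) m = gcd b m"
      by (simp add: gcd_mult_right_left_cancel gcd.commute coprime_commute)
    then show ?thesis using that(2) by (simp add: gcd_nat.absorb1)
  qed
  have split: "gcd d n * gcd d m = d" if "d dvd n * m" for d
  proof -
    obtain a b where "d = a * b" "a dvd n" "b dvd m"
      using division_decomp[of d n m] \<open>d dvd n * m\<close> by blast
    then show ?thesis using gcd1 gcd2 by simp
  qed
  have "(f \<star> g) n * (f \<star> g) m
      = (\<Sum>(a, b)\<in>{a. a dvd n} \<times> {b. b dvd m}. (f a * g (n div a)) * (f b * g (m div b)))"
    by (simp add: dirichlet_conv_def sum_product sum.cartesian_product)
  also have "\<dots> = (\<Sum>d | d dvd n * m. f d * g (n * m div d))"
  proof (rule sum.reindex_bij_witness[of _ "\<lambda>d. (gcd d n, gcd d m)" "\<lambda>(a, b). a * b"],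
         goal_cases)
    case (5 ab)
    obtain a b where ab: "ab = (a, b)" "a dvd n" "b dvd m" using 5 by auto
    from ab obtain a' b' where n': "n = a * a'" and m': "m = b * b'" by (auto elim!: dvdE)
    have pos: "a > 0" "a' > 0" "b > 0" "b' > 0" using n m n' m' by auto
    have co': "coprime a b" "coprime a' b'" using co n' m' by auto
    have "n * m div (a * b) = a' * b'" using pos by (simp add: n' m' mult.commute mult.left_commute)
    moreover have "n div a = a'" "m div b = b'" using pos by (simp_all add: n' m')
    ultimately show ?case
      using multiplicative_mult[OF f _ _ co'(1)] multiplicative_mult[OF g _ _ co'(2)] pos
      by (simp add: ab)
  qed (auto simp: gcd1 gcd2 split mult_dvd_mono)
  finally show "(f \<star> g) (n * m) = (f \<star> g) n * (f \<star> g) m"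
    by (simp add: dirichlet_conv_def)
qed

text \<open>
  Some prime divides \<open>n\<close> to a higher power than \<open>m\<close>, and the value of \<open>f\<close> at that prime power
  is a factor of \<open>f n\<close>.
\<close>
lemma multiplicative_eq_0:
  assumes f: "multiplicative f"
    and zero: "\<And>p k. prime p \<Longrightarrow> \<not> p ^ k dvd m \<Longrightarrow> f (p ^ k) = 0"
    and n: "n > 0" and nm: "\<not> n dvd m"
  shows "f n = 0"
proof -
  have "m \<noteq> 0" using nm by (intro notI) simp
  obtain p where p: "prime p" "multiplicity p n > multiplicity p m"
    using multiplicity_le_imp_dvd[of n m] n nm by (metis neq0_conv not_le)
  have pu: "\<not> is_unit p" using p(1) not_prime_unit by blast
  obtain r where r: "n = p ^ multiplicity p n * r" "\<not> p dvd r"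
    using multiplicity_decompose'[of n p] n pu by auto
  have "coprime (p ^ multiplicity p n) r"
    using p(1) r(2) by (simp add: prime_imp_coprime)
  moreover have "r > 0" using r n by (cases r) auto
  moreover have "p > 0" using p(1) by (rule prime_gt_0_nat)
  ultimately have "f n = f (p ^ multiplicity p n) * f r"
    using multiplicative_mult[OF f, of "p ^ multiplicity p n" r] r(1) by simp
  moreover have "\<not> p ^ multiplicity p n dvd m"
    using p(2) pu \<open>m \<noteq> 0\<close> by (simp add: power_dvd_iff_le_multiplicity)
  ultimately show ?thesis using zero[OF p(1)] by simp
qed

section \<open>Moebius inversion\<close>

abbreviation one :: "nat \<Rightarrow> complex" where "one \<equiv> \<lambda>_. 1"

lemma multiplicative_one: "multiplicative one"
  by (simp add: multiplicative_def)

lemma multiplicative_moebius_mu: "multiplicative moebius_mu"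
  unfolding multiplicative_def
proof (intro conjI allI impI)
  show "moebius_mu 1 = 1" by (simp add: moebius_mu_def)
next
  fix n m :: nat assume nm: "n > 0" "m > 0" "coprime n m"
  have "prime_factors n \<inter> prime_factors m = {}"
  proof (intro equals0I)
    fix p assume "p \<in> prime_factors n \<inter> prime_factors m"
    then have "p dvd n" "p dvd m" "prime p" by (auto simp: in_prime_factors_iff)
    then show False using coprime_common_divisor[OF nm(3)] not_prime_unit by blast
  qed
  then have "card (prime_factors (n * m)) = card (prime_factors n) + card (prime_factors m)"
    using nm by (simp add: prime_factors_product card_Un_disjoint)
  moreover have "squarefree (n * m) \<longleftrightarrow> squarefree n \<and> squarefree m"
    using squarefree_mult_coprime[OF nm(3)] squarefree_multD by blast
  ultimately show "moebius_mu (n * m) = moebius_mu n * moebius_mu m"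
    by (simp add: moebius_mu_def power_add)
qed

lemma moebius_mu_prime_power:
  assumes "prime p"
  shows "moebius_mu (p ^ k) = (if k = 0 then 1 else if k = 1 then -1 else 0)"
proof -
  have "\<not> is_unit p" "p > 0" using assms not_prime_unit prime_gt_0_nat by blast+
  then show ?thesis
    using assms by (auto simp: moebius_mu_def squarefree_power_iff prime_factorization_prime
      squarefree_prime)
qed

lemma dirichlet_conv_moebius_prime_power:
  assumes "prime p"
  shows "(f \<star> moebius_mu) (p ^ Suc k) = f (p ^ Suc k) - f (p ^ k)"
proof -
  have "(f \<star> moebius_mu) (p ^ Suc k)
      = (\<Sum>i\<le>Suc k. f (p ^ i) * moebius_mu (p ^ (Suc k - i)))"
    by (rule dirichlet_conv_prime_power[OF assms])
  also have "\<dots> = (\<Sum>i\<in>{k, Suc k}. f (p ^ i) * moebius_mu (p ^ (Suc k - i)))"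
    by (intro sum.mono_neutral_right) (auto simp: moebius_mu_prime_power[OF assms])
  also have "\<dots> = f (p ^ Suc k) - f (p ^ k)"
    using moebius_mu_prime_power[OF assms, of 1] moebius_mu_prime_power[OF assms, of 0]
    by (simp add: Suc_diff_le)
  finally show ?thesis .
qed

text \<open>
  The constant function has vanishing differences along the powers of each prime, so the
  multiplicative function \<open>one \<star> moebius_mu\<close> is supported on the divisors of \<open>1\<close>.
\<close>
lemma one_conv_moebius: "(one \<star> moebius_mu) n = (if n = 1 then 1 else 0)"
proof -
  have M: "multiplicative (one \<star> moebius_mu)"
    by (intro multiplicative_dirichlet_conv multiplicative_one multiplicative_moebius_mu)
  have pp: "(one \<star> moebius_mu) (p ^ k) = 0" if p: "prime p" and k: "\<not> p ^ k dvd 1" for p k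
  proof -
    obtain l where "k = Suc l" using k by (cases k) auto
    then show ?thesis using dirichlet_conv_moebius_prime_power[OF p, of one l] by simp
  qed
  consider "n = 0" | "n = 1" | "n > 0" "\<not> n dvd 1" by fastforce
  then show ?thesis
  proof cases
    case 3
    from multiplicative_eq_0[OF M pp this] 3 show ?thesis by auto
  qed (use multiplicative_1[OF M] in auto)
qed

text \<open>The value of a convolution at \<open>0\<close> is \<open>0\<close>, which forces the hypothesis on \<open>f 0\<close>.\<close>
lemma moebius_inversion:
  assumes "f 0 = 0"
  shows "(f \<star> moebius_mu) \<star> one = f"
proof
  fix n
  have "((f \<star> moebius_mu) \<star> one) n = ((one \<star> moebius_mu) \<star> f) n"
    by (simp only: dirichlet_conv_ac)
  also have "\<dots> = f n"
  proof (cases "n = 0")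
    case False
    then have "((one \<star> moebius_mu) \<star> f) n
        = (\<Sum>d\<in>{1}. (one \<star> moebius_mu) d * f (n div d))"
      unfolding dirichlet_conv_def[of "one \<star> moebius_mu"]
      by (intro sum.mono_neutral_right) (auto simp: one_conv_moebius)
    then show ?thesis by (simp add: one_conv_moebius)
  qed (use assms in simp)
  finally show "((f \<star> moebius_mu) \<star> one) n = f n" .
qed

lemma one_conv_one: "(one \<star> one) n = of_nat (tau n)"
  by (simp add: dirichlet_conv_def tau_def)

section \<open>The Dirichlet polynomial of a single factor\<close>

text \<open>
  From the exponent \<open>a\<close> of \<open>p\<close> in \<open>m\<close> on, \<open>f(p\<^sup>k)\<close> is constant in \<open>k\<close>, so its differences
  vanish beyond \<open>a\<close>. For \<open>a = 0\<close> this comes from the last condition on \<open>f\<close> together with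
  \<open>f(1) = 1\<close>, for \<open>a \<ge> 1\<close> from the condition before it.
\<close>
lemma moebius_conv_eq_0:
  assumes m: "m > 0" and f: "multiplicative f"
    and ii: "\<forall>p a. prime p \<and> a \<ge> 1 \<and> exact_power_dvd p a m \<longrightarrow>
                (\<forall>k\<ge>a. f (p ^ k) = f (p ^ a))"
    and iii: "\<forall>p. prime p \<and> gcd p m = 1 \<longrightarrow> (\<forall>k\<ge>1. f (p ^ k) = 1)"
    and n: "n > 0" "\<not> n dvd m"
  shows "(f \<star> moebius_mu) n = 0"
proof (rule multiplicative_eq_0[OF _ _ n])
  show "multiplicative (f \<star> moebius_mu)"
    by (intro multiplicative_dirichlet_conv f multiplicative_moebius_mu)
next
  fix p k assume p: "prime p" and k: "\<not> p ^ k dvd m"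
  obtain l where l: "k = Suc l" using k by (cases k) auto
  define a where "a = multiplicity p m"
  have pu: "\<not> is_unit p" using p not_prime_unit by blast
  have le: "p ^ i dvd m \<longleftrightarrow> i \<le> a" for i
    unfolding a_def using m pu by (simp add: power_dvd_iff_le_multiplicity)
  have al: "a \<le> l" using k le[of k] l by auto
  have const: "f (p ^ i) = f (p ^ a)" if "i \<ge> a" for i
  proof (cases "a = 0")
    case True
    then have "\<not> p dvd m" using le[of 1] by simp
    then have "gcd p m = 1" using prime_imp_coprime[OF p] by (simp add: coprime_iff_gcd_eq_1)
    then have "f (p ^ j) = 1" for j
      using iii p multiplicative_1[OF f] by (cases j) (auto simp del: power_Suc)
    then show ?thesis by simp
  next
    case False
    then have "exact_power_dvd p a m"
      unfolding exact_power_dvd_def using le[of a] le[of "Suc a"] by simp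
    then show ?thesis using ii p False that by (metis One_nat_def Suc_leI neq0_conv)
  qed
  show "(f \<star> moebius_mu) (p ^ k) = 0"
    using const[of l] const[of "Suc l"] al
    by (simp add: l dirichlet_conv_moebius_prime_power[OF p] del: power_Suc)
qed

text \<open>
  On the level of power series this is \<open>\<Sum>\<^sub>k g(q\<^sup>k) z\<^sup>k = (1 - z) \<Sum>\<^sub>k f(q\<^sup>k) z\<^sup>k\<close> at \<open>z = 1/q\<close>, where
  the left-hand side is a polynomial of degree at most \<open>a\<close> in \<open>z\<close>.
\<close>
lemma local_factor_eq_0:
  assumes q: "prime q" and f1: "f 1 = 1"
    and sums: "(\<lambda>k. f (q ^ k) / of_nat (q ^ k)) sums 0"
    and supp: "\<And>k. k > a \<Longrightarrow> (f \<star> moebius_mu) (q ^ k) = 0"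
  shows "(\<Sum>k\<le>a. (f \<star> moebius_mu) (q ^ k) / of_nat (q ^ k)) = 0"
proof -
  define F where "F = (\<lambda>k. f (q ^ k) / of_nat (q ^ k))"
  define H where "H = (\<lambda>k. (f \<star> moebius_mu) (q ^ k) / of_nat (q ^ k))"
  have q0: "q > 0" using q by (rule prime_gt_0_nat)
  have F: "F sums 0" using sums by (simp add: F_def)
  have H0: "H 0 = F 0"
    using dirichlet_conv_prime_power[OF q, of f moebius_mu 0] moebius_mu_prime_power[OF q, of 0]
    by (simp add: H_def F_def)
  have HS: "H (Suc k) = F (Suc k) - F k / of_nat q" for k
    using q0 dirichlet_conv_moebius_prime_power[OF q, of f k]
    by (simp add: H_def F_def diff_divide_distrib)
  have "(\<lambda>k. F (Suc k)) sums (0 - F 0)"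
    using F by (simp add: sums_Suc_iff)
  from sums_diff[OF this sums_divide[OF F, of "of_nat q"]]
  have "(\<lambda>k. H (Suc k)) sums (- H 0)" by (simp add: HS H0)
  then have "H sums 0" by (simp add: sums_Suc_iff)
  moreover have "H sums (\<Sum>k\<le>a. H k)"
    by (rule sums_finite) (auto simp: H_def supp)
  ultimately have "(\<Sum>k\<le>a. H k) = 0" by (rule sums_unique2[symmetric])
  then show ?thesis by (simp add: H_def)
qed

text \<open>
  The sum of a multiplicative function \<open>h\<close> over the divisors of \<open>m\<close> is the value at \<open>m\<close> of
  the multiplicative function \<open>h \<star> 1\<close>; hence the local factor at \<open>q\<close> splits off.
\<close>
lemma sum_moebius_conv_over_id_eq_0:
  assumes m: "m > 0" and f: "multiplicative f"
    and i: "\<exists>q. prime q \<and> q dvd m \<and> (\<lambda>k. f (q ^ k) / of_nat (q ^ k)) sums 0"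
    and supp: "\<And>n. n > 0 \<Longrightarrow> \<not> n dvd m \<Longrightarrow> (f \<star> moebius_mu) n = 0"
  shows "(\<Sum>d | d dvd m. (f \<star> moebius_mu) d / of_nat d) = 0"
proof -
  obtain q where q: "prime q" and sums: "(\<lambda>k. f (q ^ k) / of_nat (q ^ k)) sums 0"
    using i by blast
  have qu: "\<not> is_unit q" using q not_prime_unit by blast
  have q0: "q > 0" using q by (rule prime_gt_0_nat)
  define a where "a = multiplicity q m"
  obtain r where r: "m = q ^ a * r" "\<not> q dvd r"
    unfolding a_def using multiplicity_decompose'[of m q] m qu by auto
  define h where "h = (\<lambda>d. (f \<star> moebius_mu) d / of_nat d)"
  have "multiplicative (f \<star> moebius_mu)"
    by (intro multiplicative_dirichlet_conv f multiplicative_moebius_mu)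
  then have "multiplicative h"
    by (auto simp: multiplicative_def h_def)
  then have M: "multiplicative (h \<star> one)"
    by (intro multiplicative_dirichlet_conv multiplicative_one)
  have "r > 0" using r m by (cases r) auto
  moreover have "coprime (q ^ a) r" using q r(2) by (simp add: prime_imp_coprime)
  ultimately have "(h \<star> one) m = (h \<star> one) (q ^ a) * (h \<star> one) r"
    using multiplicative_mult[OF M, of "q ^ a" r] q0 r(1) by simp
  also have "(h \<star> one) (q ^ a) = (\<Sum>k\<le>a. (f \<star> moebius_mu) (q ^ k) / of_nat (q ^ k))"
    using dirichlet_conv_prime_power[OF q, of h one a] by (simp add: h_def)
  also have "\<dots> = 0"
  proof (rule local_factor_eq_0[OF q _ sums])
    show "f 1 = 1" using multiplicative_1[OF f] by simp
    fix k assume "k > a"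
    then have "\<not> q ^ k dvd m"
      unfolding a_def using m qu by (simp add: power_dvd_iff_le_multiplicity)
    then show "(f \<star> moebius_mu) (q ^ k) = 0" using supp q0 by simp
  qed
  finally show ?thesis by (simp add: dirichlet_conv_def h_def)
qed

section \<open>Convolutions of finitely supported functions\<close>

lemma dirichlet_conv_eq_0:
  assumes "\<And>n. n > 0 \<Longrightarrow> \<not> n dvd m1 \<Longrightarrow> g1 n = 0"
    and "\<And>n. n > 0 \<Longrightarrow> \<not> n dvd m2 \<Longrightarrow> g2 n = 0"
    and n: "n > 0" "\<not> n dvd m1 * m2"
  shows "(g1 \<star> g2) n = 0"
  unfolding dirichlet_conv_def
proof (intro sum.neutral ballI)
  fix d assume "d \<in> {d. d dvd n}"
  then obtain e where e: "n = d * e" by auto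
  then have "d > 0" "e > 0" using n by auto
  moreover have "\<not> d dvd m1 \<or> \<not> e dvd m2" using n e mult_dvd_mono by blast
  ultimately show "g1 d * g2 (n div d) = 0" using assms e by auto
qed

lemma sum_dirichlet_conv_divisors:
  assumes m: "m1 > 0" "m2 > 0"
    and supp1: "\<And>n. n > 0 \<Longrightarrow> \<not> n dvd m1 \<Longrightarrow> g1 n = 0"
    and supp2: "\<And>n. n > 0 \<Longrightarrow> \<not> n dvd m2 \<Longrightarrow> g2 n = 0"
  shows "(\<Sum>d | d dvd m1 * m2. (g1 \<star> g2) d * \<phi> d)
       = (\<Sum>a | a dvd m1. \<Sum>b | b dvd m2. g1 a * g2 b * \<phi> (a * b))"
proof -
  let ?D = "{d. d dvd m1 * m2}"
  have fin: "finite {(a, b). a * b \<in> ?D}"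
  proof (rule finite_subset)
    show "{(a, b). a * b \<in> ?D} \<subseteq> ?D \<times> ?D" by (auto intro: dvd_mult_left dvd_mult_right)
    show "finite (?D \<times> ?D)" using m by simp
  qed
  have "(\<Sum>d\<in>?D. (g1 \<star> g2) d * \<phi> d) = (\<Sum>(a, b) | a * b \<in> ?D. g1 a * g2 b * \<phi> (a * b))"
    using m by (intro sum_dirichlet_conv) auto
  also have "\<dots> = (\<Sum>(a, b)\<in>{a. a dvd m1} \<times> {b. b dvd m2}. g1 a * g2 b * \<phi> (a * b))"
  proof (rule sum.mono_neutral_right[OF fin])
    show "{a. a dvd m1} \<times> {b. b dvd m2} \<subseteq> {(a, b). a * b \<in> ?D}"
      by (auto intro: mult_dvd_mono)
    show "\<forall>ab\<in>{(a, b). a * b \<in> ?D} - {a. a dvd m1} \<times> {b. b dvd m2}.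
            (case ab of (a, b) \<Rightarrow> g1 a * g2 b * \<phi> (a * b)) = 0"
    proof
      fix ab assume "ab \<in> {(a, b). a * b \<in> ?D} - {a. a dvd m1} \<times> {b. b dvd m2}"
      then obtain a b where ab: "ab = (a, b)" "a * b dvd m1 * m2" "\<not> a dvd m1 \<or> \<not> b dvd m2"
        by auto
      then have "a > 0" "b > 0" using m by (auto intro!: gr0I)
      then show "(case ab of (a, b) \<Rightarrow> g1 a * g2 b * \<phi> (a * b)) = 0"
        using ab supp1 supp2 by auto
    qed
  qed
  also have "\<dots> = (\<Sum>a | a dvd m1. \<Sum>b | b dvd m2. g1 a * g2 b * \<phi> (a * b))"
    by (simp add: sum.cartesian_product)
  finally show ?thesis .
qed

text \<open>
  The second sum is, up to sign, the derivative at \<open>s = 1\<close> of a product of two Dirichlet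
  polynomials that both vanish there; since \<open>ln (a b) = ln a + ln b\<close>, Leibniz' rule is a
  splitting of the double sum.
\<close>
lemma double_zero:
  assumes m: "m1 > 0" "m2 > 0"
    and supp1: "\<And>n. n > 0 \<Longrightarrow> \<not> n dvd m1 \<Longrightarrow> g1 n = 0"
    and supp2: "\<And>n. n > 0 \<Longrightarrow> \<not> n dvd m2 \<Longrightarrow> g2 n = 0"
    and zero1: "(\<Sum>d | d dvd m1. g1 d / of_nat d) = 0"
    and zero2: "(\<Sum>d | d dvd m2. g2 d / of_nat d) = 0"
  shows "(\<Sum>d | d dvd m1 * m2. (g1 \<star> g2) d / of_nat d) = 0"
    and "(\<Sum>d | d dvd m1 * m2. (g1 \<star> g2) d * (of_real (ln (real d)) / of_nat d)) = 0"
proof -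
  note S = sum_dirichlet_conv_divisors[where ?g1.0 = g1 and ?g2.0 = g2, OF m supp1 supp2]
  have "(\<Sum>d | d dvd m1 * m2. (g1 \<star> g2) d * (1 / of_nat d))
      = (\<Sum>a | a dvd m1. \<Sum>b | b dvd m2. (g1 a / of_nat a) * (g2 b / of_nat b))"
    by (subst S) auto
  also have "\<dots> = (\<Sum>d | d dvd m1. g1 d / of_nat d) * (\<Sum>d | d dvd m2. g2 d / of_nat d)"
    by (simp only: sum_product)
  finally show "(\<Sum>d | d dvd m1 * m2. (g1 \<star> g2) d / of_nat d) = 0"
    by (simp add: zero1)
  define L where "L = (\<lambda>g :: nat \<Rightarrow> complex. \<lambda>d. g d * of_real (ln (real d)) / of_nat d)"
  have "(\<Sum>d | d dvd m1 * m2. (g1 \<star> g2) d * (of_real (ln (real d)) / of_nat d))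
      = (\<Sum>a | a dvd m1. \<Sum>b | b dvd m2.
           g1 a * g2 b * (of_real (ln (real (a * b))) / of_nat (a * b)))"
    by (rule S)
  also have "\<dots> = (\<Sum>a | a dvd m1. \<Sum>b | b dvd m2.
                    L g1 a * (g2 b / of_nat b) + (g1 a / of_nat a) * L g2 b)"
  proof (intro sum.cong refl)
    fix a b assume "a \<in> {a. a dvd m1}" "b \<in> {b. b dvd m2}"
    then have "a > 0" "b > 0" using m by (auto intro!: gr0I)
    then show "g1 a * g2 b * (of_real (ln (real (a * b))) / of_nat (a * b))
             = L g1 a * (g2 b / of_nat b) + (g1 a / of_nat a) * L g2 b"
      by (simp add: L_def ln_mult field_simps)
  qed
  also have "\<dots> = (\<Sum>a | a dvd m1. L g1 a) * (\<Sum>b | b dvd m2. g2 b / of_nat b)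
                + (\<Sum>a | a dvd m1. g1 a / of_nat a) * (\<Sum>b | b dvd m2. L g2 b)"
    by (simp only: sum_product sum.distrib)
  finally show "(\<Sum>d | d dvd m1 * m2. (g1 \<star> g2) d * (of_real (ln (real d)) / of_nat d)) = 0"
    by (simp add: zero1 zero2)
qed

lemma finite_nat_le_real: "finite {n. 0 < n \<and> real n \<le> x}"
  by (rule finite_subset[of _ "{..nat \<lfloor>x\<rfloor>}"]) (auto simp: le_nat_floor)

text \<open>
  Write \<open>n = d k\<close> and sum over \<open>k\<close> first. A divisor \<open>d > x\<close> of \<open>N\<close> is harmless on the right,
  as its inner sum is empty.
\<close>
lemma summatory_dirichlet_conv:
  assumes N: "N > 0" and supp: "\<And>n. n > 0 \<Longrightarrow> \<not> n dvd N \<Longrightarrow> g n = 0"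
  shows "(\<Sum>n | 0 < n \<and> real n \<le> x. (g \<star> t) n)
       = (\<Sum>d | d dvd N. g d * (\<Sum>k | 0 < k \<and> real k \<le> x / real d. t k))"
proof -
  let ?A = "{n. 0 < n \<and> real n \<le> x}"
  let ?B = "SIGMA d:{d. d dvd N}. {k. 0 < k \<and> real k \<le> x / real d}"
  have B: "(d, k) \<in> ?B \<longleftrightarrow> d * k \<in> ?A \<and> d dvd N" for d k
    using N by (auto simp: field_simps intro!: gr0I)
  have fin: "finite {(a, b). a * b \<in> ?A}"
  proof (rule finite_subset)
    show "{(a, b). a * b \<in> ?A} \<subseteq> ?A \<times> ?A"
    proof
      fix ab assume "ab \<in> {(a, b). a * b \<in> ?A}"
      then obtain a b where ab: "ab = (a, b)" "0 < a * b" "real (a * b) \<le> x" by auto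
      then have "a \<le> a * b" "b \<le> a * b" by auto
      then have "real a \<le> x" "real b \<le> x" using ab(3) by linarith+
      then show "ab \<in> ?A \<times> ?A" using ab(1,2) by simp
    qed
  qed (intro finite_cartesian_product finite_nat_le_real)
  have "(\<Sum>n\<in>?A. (g \<star> t) n) = (\<Sum>n\<in>?A. (g \<star> t) n * 1)" by simp
  also have "\<dots> = (\<Sum>(a, b) | a * b \<in> ?A. g a * t b * 1)"
    by (rule sum_dirichlet_conv[OF finite_nat_le_real, where \<phi> = "\<lambda>_. 1"]) simp
  also have "\<dots> = (\<Sum>(a, b)\<in>?B. g a * t b * 1)"
  proof (rule sum.mono_neutral_right[OF fin])
    show "?B \<subseteq> {(a, b). a * b \<in> ?A}" using B by blast
    show "\<forall>ab\<in>{(a, b). a * b \<in> ?A} - ?B. (case ab of (a, b) \<Rightarrow> g a * t b * 1) = 0"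
    proof
      fix ab assume "ab \<in> {(a, b). a * b \<in> ?A} - ?B"
      then obtain a b where ab: "ab = (a, b)" "a * b \<in> ?A" "(a, b) \<notin> ?B" by blast
      then have "\<not> a dvd N" using B by blast
      moreover have "a > 0" using ab(2) by (auto intro!: gr0I)
      ultimately show "(case ab of (a, b) \<Rightarrow> g a * t b * 1) = 0" using supp by (simp add: ab(1))
    qed
  qed
  also have "\<dots> = (\<Sum>d | d dvd N. \<Sum>k | 0 < k \<and> real k \<le> x / real d. g d * t k)"
    using N by (subst sum.Sigma) (auto intro: finite_nat_le_real)
  finally show ?thesis by (simp add: sum_distrib_left)
qed

section \<open>The identity for the summatory function\<close>

theorem theorem1p4:
  fixes m1 m2 :: nat and f1 f2 f :: "nat \<Rightarrow> complex" and x :: real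
  assumes "m1 > 0" and "m2 > 0"
    and "multiplicative f1" and "multiplicative f2"
    and "has_period f1 m1" and "has_period f2 m2"
    and i1: "\<exists>q. prime q \<and> q dvd m1 \<and> (\<lambda>k. f1 (q ^ k) / of_nat (q ^ k)) sums 0"
    and i2: "\<exists>q. prime q \<and> q dvd m2 \<and> (\<lambda>k. f2 (q ^ k) / of_nat (q ^ k)) sums 0"
    and ii1: "\<forall>p a. prime p \<and> a \<ge> 1 \<and> exact_power_dvd p a m1 \<longrightarrow>
                (\<forall>k\<ge>a. f1 (p ^ k) = f1 (p ^ a))"
    and ii2: "\<forall>p a. prime p \<and> a \<ge> 1 \<and> exact_power_dvd p a m2 \<longrightarrow>
                (\<forall>k\<ge>a. f2 (p ^ k) = f2 (p ^ a))"
    and iii1: "\<forall>p. prime p \<and> gcd p m1 = 1 \<longrightarrow> (\<forall>k\<ge>1. f1 (p ^ k) = 1)"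
    and iii2: "\<forall>p. prime p \<and> gcd p m2 = 1 \<longrightarrow> (\<forall>k\<ge>1. f2 (p ^ k) = 1)"
    and f: "f = f1 \<star> f2"
    and x: "x > real (m1 * m2)"
  shows "(\<Sum>n | 0 < n \<and> real n \<le> x. f n) =
         (\<Sum>n | n dvd m1 * m2.
            (f \<star> moebius_mu \<star> moebius_mu) n * complex_of_real (divisor_Delta (x / real n)))"
proof -
  define G where "G = f \<star> moebius_mu \<star> moebius_mu"
  define N where "N = m1 * m2"
  have N: "N > 0" using assms(1,2) by (simp add: N_def)
  have x0: "x > 0" using x of_nat_0_le_iff[of "m1 * m2", where ?'a = real] by linarith
  note supp1 = moebius_conv_eq_0[OF assms(1,3) ii1 iii1]
  note supp2 = moebius_conv_eq_0[OF assms(2,4) ii2 iii2]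
  note zero1 = sum_moebius_conv_over_id_eq_0[OF assms(1,3) i1 supp1]
  note zero2 = sum_moebius_conv_over_id_eq_0[OF assms(2,4) i2 supp2]
  have G: "G = (f1 \<star> moebius_mu) \<star> (f2 \<star> moebius_mu)"
    unfolding G_def f by (simp only: dirichlet_conv_ac)
  have suppG: "G n = 0" if "n > 0" "\<not> n dvd N" for n
    using dirichlet_conv_eq_0[OF supp1 supp2 that[unfolded N_def]] by (simp add: G)
  have G1: "(\<Sum>d | d dvd N. G d / of_nat d) = 0"
    unfolding G N_def by (rule double_zero(1)[OF assms(1,2) supp1 supp2 zero1 zero2])
  have G2: "(\<Sum>d | d dvd N. G d * (of_real (ln (real d)) / of_nat d)) = 0"
    unfolding G N_def by (rule double_zero(2)[OF assms(1,2) supp1 supp2 zero1 zero2])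
  have "G \<star> (one \<star> one) = ((f \<star> moebius_mu) \<star> moebius_mu) \<star> one \<star> one"
    unfolding G_def by (simp only: dirichlet_conv_assoc)
  also have "\<dots> = f"
    by (simp add: moebius_inversion f)
  finally have fG: "f = G \<star> (\<lambda>n. of_nat (tau n))"
    by (simp add: one_conv_one[abs_def])
  \<comment> \<open>The main term of the divisor sum at \<open>x/d\<close> is \<open>x c / d - x (ln d) / d\<close>.\<close>
  define c where "c = complex_of_real (ln x + 2 * euler_mascheroni - 1)"
  have T: "G d * (\<Sum>k | 0 < k \<and> real k \<le> x / real d. of_nat (tau k))
         = G d * of_real (divisor_Delta (x / real d))
           + (of_real x * c * (G d / of_nat d)
              - of_real x * (G d * (of_real (ln (real d)) / of_nat d)))"
    if "d dvd N" for d
  proof -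
    have d: "d > 0" using that N by (auto intro!: gr0I)
    have "(\<Sum>k | 0 < k \<and> real k \<le> x / real d. real (tau k))
        = divisor_Delta (x / real d) + x * (ln x + 2 * euler_mascheroni - 1) / real d
          - x * (ln (real d) / real d)"
      unfolding divisor_Delta_def using d x0 by (simp add: ln_div field_simps)
    then have "complex_of_real (\<Sum>k | 0 < k \<and> real k \<le> x / real d. real (tau k))
        = of_real (divisor_Delta (x / real d)) + of_real x * c / of_nat d
          - of_real x * (of_real (ln (real d)) / of_nat d)"
      by (simp add: c_def)
    then have "(\<Sum>k | 0 < k \<and> real k \<le> x / real d. complex_of_nat (tau k))
        = of_real (divisor_Delta (x / real d)) + of_real x * c / of_nat d
          - of_real x * (of_real (ln (real d)) / of_nat d)"
      by simp
    then show ?thesis by (simp only:) (simp add: algebra_simps)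
  qed
  have "(\<Sum>n | 0 < n \<and> real n \<le> x. f n)
      = (\<Sum>d | d dvd N. G d * (\<Sum>k | 0 < k \<and> real k \<le> x / real d. of_nat (tau k)))"
    unfolding fG by (rule summatory_dirichlet_conv[OF N suppG])
  also have "\<dots> = (\<Sum>d | d dvd N. G d * of_real (divisor_Delta (x / real d))
           + (of_real x * c * (G d / of_nat d)
              - of_real x * (G d * (of_real (ln (real d)) / of_nat d))))"
    by (intro sum.cong refl T) simp
  also have "\<dots> = (\<Sum>d | d dvd N. G d * of_real (divisor_Delta (x / real d)))
      + (of_real x * c * (\<Sum>d | d dvd N. G d / of_nat d)
         - of_real x * (\<Sum>d | d dvd N. G d * (of_real (ln (real d)) / of_nat d)))"
    by (simp only: sum.distrib sum_subtractf sum_distrib_left)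
  also have "\<dots> = (\<Sum>d | d dvd N. G d * of_real (divisor_Delta (x / real d)))"
    by (simp only: G1 G2) simp
  finally show ?thesis by (simp only: G_def N_def)
qed

end
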